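(* Let $d,n\in\mathbb{N}$. Then there exists a set $U\subseteq\mathbb{R}^d$ of $n$ points such that every (possibly improper and randomized) two-party protocol that learns halfspaces over $U$ must transmit at least $\Omega(d\log(n/d))$ bits of communication.
   Context: A halfspace in $\mathbb{R}^d$ is a set of the form $\{x:\langle a,x\rangle< b\}$ or $\{x:\langle a,x\rangle\le b\}$. An example is a pair $(u,y)\in U\times\{\pm1\}$ (positive if $y=+1$, negative if $y=-1$); a sample is a set of examples. Learning halfspaces over $U$: Alice holds a sample $S_a\subseteq U\times\{\pm1\}$, Bob holds a sample $S_b\subseteq U\times\{\pm1\}$, with the promise that some halfspace contains all positive examples of $S_a\cup S_b$ and no negative example of $S_a\cup S_b$; they must output a function $f:U\to\{\pm1\}$ (not necessarily a halfspace indicator, i.e. the protocol may be improper) with $f(x)=y$ for all $(x,y)\in S_a\cup S_b$. A randomized protocol must output such a function with probability at least $2/3$. *)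

theory Defs
  imports "HOL-Probability.Probability_Mass_Function" "Jordan_Normal_Form.Matrix"
begin

(* Euclidean space R^d is carrier_vec d :: real vec set, so that the dimension is a term and
   the constant hidden in Omega can be quantified before it. *)

definition halfspaces :: "nat \<Rightarrow> real vec set set" where
  "halfspaces d =
     {{x \<in> carrier_vec d. scalar_prod a x < b} | a b. a \<in> carrier_vec d} \<union>
     {{x \<in> carrier_vec d. scalar_prod a x \<le> b} | a b. a \<in> carrier_vec d}"

type_synonym sample = "(real vec \<times> int) set"

definition learning_inputs :: "nat \<Rightarrow> real vec set \<Rightarrow> (sample \<times> sample) set" where
  "learning_inputs d U =
     {(S\<^sub>a, S\<^sub>b). S\<^sub>a \<subseteq> U \<times> {1, -1} \<and> S\<^sub>b \<subseteq> U \<times> {1, -1} \<and>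
        (\<exists>H\<in>halfspaces d. \<forall>(x, y)\<in>S\<^sub>a \<union> S\<^sub>b. (y = 1 \<longrightarrow> x \<in> H) \<and> (y = -1 \<longrightarrow> x \<notin> H))}"

definition correct_outputs :: "real vec set \<Rightarrow> sample \<Rightarrow> sample \<Rightarrow> (real vec \<Rightarrow> int) set" where
  "correct_outputs U S\<^sub>a S\<^sub>b = {f \<in> U \<rightarrow> {1, -1}. \<forall>(x, y)\<in>S\<^sub>a \<union> S\<^sub>b. f x = y}"

(* Deterministic protocols in Yao's model: at an inner node the named party sends one bit,
   computed from its own input, and the bit selects the subtree (True: the first one).
   A leaf carries the output, which is thus determined by the transcript. *)

datatype ('x, 'y, 'z) protocol =
    Output 'z
  | Alice "'x \<Rightarrow> bool" "('x, 'y, 'z) protocol" "('x, 'y, 'z) protocol"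
  | Bob "'y \<Rightarrow> bool" "('x, 'y, 'z) protocol" "('x, 'y, 'z) protocol"

primrec run_protocol :: "('x, 'y, 'z) protocol \<Rightarrow> 'x \<Rightarrow> 'y \<Rightarrow> 'z" where
  "run_protocol (Output z) x y = z"
| "run_protocol (Alice g p q) x y = (if g x then run_protocol p x y else run_protocol q x y)"
| "run_protocol (Bob g p q) x y = (if g y then run_protocol p x y else run_protocol q x y)"

primrec bits_sent :: "('x, 'y, 'z) protocol \<Rightarrow> 'x \<Rightarrow> 'y \<Rightarrow> nat" where
  "bits_sent (Output z) x y = 0"
| "bits_sent (Alice g p q) x y = Suc (if g x then bits_sent p x y else bits_sent q x y)"
| "bits_sent (Bob g p q) x y = Suc (if g y then bits_sent p x y else bits_sent q x y)"

(* A randomized protocol is a public-coin one, i.e. a distribution over deterministic protocols;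
   private coins are the special case in which each party ignores the other's random string. *)

type_synonym learning_protocol = "(sample, sample, real vec \<Rightarrow> int) protocol pmf"

definition learns_halfspaces :: "nat \<Rightarrow> real vec set \<Rightarrow> learning_protocol \<Rightarrow> bool" where
  "learns_halfspaces d U P \<longleftrightarrow>
     (\<forall>(S\<^sub>a, S\<^sub>b)\<in>learning_inputs d U.
        measure_pmf.prob P {p. run_protocol p S\<^sub>a S\<^sub>b \<in> correct_outputs U S\<^sub>a S\<^sub>b} \<ge> 2 / 3)"

(* At least t bits are transmitted in the worst case over inputs satisfying the promise and
   over outcomes of the coins. *)

definition transmits_at_least :: "nat \<Rightarrow> real vec set \<Rightarrow> learning_protocol \<Rightarrow> real \<Rightarrow> bool" where
  "transmits_at_least d U P t \<longleftrightarrow>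
     (\<exists>(S\<^sub>a, S\<^sub>b)\<in>learning_inputs d U. \<exists>p\<in>set_pmf P. real (bits_sent p S\<^sub>a S\<^sub>b) \<ge> t)"

end

(* The transcript determines the output function, so a protocol needs one leaf for every labelling
   of U that it gets right when Alice holds all of U; randomization only costs the factor 2/3.
   It remains to find n points with many halfspace labellings: distribute them over the d
   coordinate axes, at the integers 1, 2, ... on each axis.  The halfspace
   sum_i x_i / (s_i + 1/2) <= 1 contains exactly the first s_i points of the i-th axis, whence at
   least (n div d + 1)^d labellings. *)

theory Submission
  imports Defs
begin

section \<open>Counting the outputs of protocols\<close>

text \<open>The bit sent at the root splits \<open>I\<close> in two, and each subprotocol has one
  bit less to spend on its share. The length is bounded on \<open>I\<close> only, since a protocol
  may run longer on inputs that violate the promise.\<close>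

lemma card_outputs_le:
  assumes "\<And>x y. (x, y) \<in> I \<Longrightarrow> bits_sent p x y \<le> T"
  shows "finite ((\<lambda>(x, y). run_protocol p x y) ` I) \<and>
         card ((\<lambda>(x, y). run_protocol p x y) ` I) \<le> 2 ^ T"
  using assms
proof (induction p arbitrary: T I)
  case (Output z)
  have "(\<lambda>(x, y). run_protocol (Output z) x y) ` I \<subseteq> {z}"
    by auto
  from finite_subset[OF this] card_mono[OF _ this] show ?case
    using one_le_power[of "2::nat" T] by (auto intro: order_trans)
next
  case (Alice g p q)
  show ?case
  proof (cases "I = {}")
    case False
    \<comment> \<open>Some pair of \<open>I\<close> makes the root send its bit, so \<open>T\<close>
      is positive. For empty \<open>I\<close>, \<open>T\<close> may be 0.\<close>
    then obtain S where T: "T = Suc S"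
      using Alice.prems by (cases T) fastforce+
    let ?I = "{(x, y). (x, y) \<in> I \<and> g x}" and ?J = "{(x, y). (x, y) \<in> I \<and> \<not> g x}"
    have p: "finite ((\<lambda>(x, y). run_protocol p x y) ` ?I) \<and>
             card ((\<lambda>(x, y). run_protocol p x y) ` ?I) \<le> 2 ^ S"
      using Alice.prems unfolding T by (intro Alice.IH) fastforce
    have q: "finite ((\<lambda>(x, y). run_protocol q x y) ` ?J) \<and>
             card ((\<lambda>(x, y). run_protocol q x y) ` ?J) \<le> 2 ^ S"
      using Alice.prems unfolding T by (intro Alice.IH) fastforce
    have eq: "(\<lambda>(x, y). run_protocol (Alice g p q) x y) ` I =
        (\<lambda>(x, y). run_protocol p x y) ` ?I \<union> (\<lambda>(x, y). run_protocol q x y) ` ?J"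
      by (force simp: image_iff)
    show ?thesis
      unfolding eq T using p q
        card_Un_le[of "(\<lambda>(x, y). run_protocol p x y) ` ?I" "(\<lambda>(x, y). run_protocol q x y) ` ?J"]
      by simp
  qed simp
next
  case (Bob g p q)
  show ?case
  proof (cases "I = {}")
    case False
    then obtain S where T: "T = Suc S"
      using Bob.prems by (cases T) fastforce+
    let ?I = "{(x, y). (x, y) \<in> I \<and> g y}" and ?J = "{(x, y). (x, y) \<in> I \<and> \<not> g y}"
    have p: "finite ((\<lambda>(x, y). run_protocol p x y) ` ?I) \<and>
             card ((\<lambda>(x, y). run_protocol p x y) ` ?I) \<le> 2 ^ S"
      using Bob.prems unfolding T by (intro Bob.IH) fastforce
    have q: "finite ((\<lambda>(x, y). run_protocol q x y) ` ?J) \<and>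
             card ((\<lambda>(x, y). run_protocol q x y) ` ?J) \<le> 2 ^ S"
      using Bob.prems unfolding T by (intro Bob.IH) fastforce
    have eq: "(\<lambda>(x, y). run_protocol (Bob g p q) x y) ` I =
        (\<lambda>(x, y). run_protocol p x y) ` ?I \<union> (\<lambda>(x, y). run_protocol q x y) ` ?J"
      by (force simp: image_iff)
    show ?thesis
      unfolding eq T using p q
        card_Un_le[of "(\<lambda>(x, y). run_protocol p x y) ` ?I" "(\<lambda>(x, y). run_protocol q x y) ` ?J"]
      by simp
  qed simp
qed

text \<open>Averaging: the expected number of inputs in \<open>F\<close> that are answered correctly
  is at least \<open>\<delta> * card F\<close>, while each deterministic protocol in the support
  answers at most \<open>2 ^ T\<close> of them, one per output.\<close>

lemma randomized_counting_bound:
  fixes P :: "('x, 'y, 'z) protocol pmf" and C :: "'x \<times> 'y \<Rightarrow> 'z set"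
  assumes fin: "finite F"
    and bits: "\<And>p x y. p \<in> set_pmf P \<Longrightarrow> (x, y) \<in> F \<Longrightarrow> bits_sent p x y \<le> T"
    and disj: "disjoint_family_on C F"
    and succ: "\<And>x y. (x, y) \<in> F \<Longrightarrow>
      measure_pmf.prob P {p. run_protocol p x y \<in> C (x, y)} \<ge> \<delta>"
  shows "\<delta> * real (card F) \<le> 2 ^ T"
proof -
  define run where "run = (\<lambda>p (x :: 'x, y :: 'y). run_protocol p x y :: 'z)"
  define A where "A w = {p. run p w \<in> C w}" for w
  have int: "integrable (measure_pmf P) (indicator (A w) :: _ \<Rightarrow> real)" for w
    by (rule measure_pmf.integrable_const_bound[where B = 1]) (auto simp: indicator_def)
  have "\<delta> * real (card F) = (\<Sum>w\<in>F. \<delta>)"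
    by simp
  also have "\<dots> \<le> (\<Sum>w\<in>F. measure_pmf.prob P (A w))"
    using succ by (intro sum_mono) (auto simp: A_def run_def)
  also have "\<dots> = measure_pmf.expectation P (\<lambda>p. \<Sum>w\<in>F. indicator (A w) p)"
    by (subst Bochner_Integration.integral_sum) (auto simp: int)
  also have "\<dots> \<le> 2 ^ T"
  proof (intro measure_pmf.integral_le_const Bochner_Integration.integrable_sum int)
    show "AE p in measure_pmf P. (\<Sum>w\<in>F. indicator (A w) p) \<le> (2 ^ T :: real)"
    proof (rule AE_pmfI)
      fix p assume p: "p \<in> set_pmf P"
      let ?G = "{w \<in> F. p \<in> A w}"
      \<comment> \<open>Correct answers to different inputs lie in disjoint sets, so no output
        serves two inputs.\<close>
      have "inj_on (run p) ?G"
      proof (rule inj_onI, rule ccontr)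
        fix v w assume v: "v \<in> ?G" and w: "w \<in> ?G" and eq: "run p v = run p w" and "v \<noteq> w"
        then have "C v \<inter> C w = {}"
          using disj by (simp add: disjoint_family_on_def)
        moreover have "run p v \<in> C v" "run p w \<in> C w"
          using v w by (simp_all add: A_def)
        ultimately show False
          using eq by auto
      qed
      then have "card ?G = card (run p ` ?G)"
        by (simp add: card_image)
      also have "\<dots> \<le> 2 ^ T"
        using card_outputs_le[of ?G p T] bits[OF p] by (auto simp: run_def)
      finally have "real (card ?G) \<le> 2 ^ T"
        by simp
      moreover have "(\<Sum>w\<in>F. indicator (A w) p) = real (card ?G)"
        using fin by (simp add: indicator_def sum.If_cases Int_def)
      ultimately show "(\<Sum>w\<in>F. indicator (A w) p) \<le> (2 ^ T :: real)"
        by simp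
    qed
  qed
  finally show ?thesis .
qed

section \<open>Points on the axes and the halfspaces that cut them\<close>

text \<open>The remainder of \<open>k\<close> selects the axis and the quotient the position, so the
  indices below \<open>n\<close> fill at least the first \<open>n div d\<close> positions of every
  axis.\<close>

definition axis_point :: "nat \<Rightarrow> nat \<Rightarrow> real vec" where
  "axis_point d k = (real (k div d) + 1) \<cdot>\<^sub>v unit_vec d (k mod d)"

text \<open>The cut at \<open>s i + 1 / 2\<close> lies strictly between two integers, and the
  denominator stays positive when \<open>s i = 0\<close>.\<close>

definition axis_halfspace :: "nat \<Rightarrow> (nat \<Rightarrow> nat) \<Rightarrow> real vec set" where
  "axis_halfspace d s =
     {x \<in> carrier_vec d. scalar_prod (vec d (\<lambda>i. 1 / (real (s i) + 1 / 2))) x \<le> 1}"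

lemma axis_halfspace_in_halfspaces: "axis_halfspace d s \<in> halfspaces d"
  unfolding axis_halfspace_def halfspaces_def
  by (intro UnI2 CollectI exI[of _ "vec d (\<lambda>i. 1 / (real (s i) + 1 / 2))"] exI[of _ 1]) simp

lemma axis_point_carrier: "axis_point d k \<in> carrier_vec d"
  by (simp add: axis_point_def)

lemma axis_point_in_axis_halfspace:
  assumes "d \<ge> 1"
  shows "axis_point d k \<in> axis_halfspace d s \<longleftrightarrow> k div d < s (k mod d)"
proof -
  have "k mod d < d"
    using assms by simp
  then have "scalar_prod (vec d (\<lambda>i. 1 / (real (s i) + 1 / 2))) (axis_point d k) =
      (real (k div d) + 1) / (real (s (k mod d)) + 1 / 2)"
    by (simp add: axis_point_def)
  also have "\<dots> \<le> 1 \<longleftrightarrow> k div d < s (k mod d)"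
    by (simp add: divide_le_eq add_pos_nonneg) linarith
  finally show ?thesis
    by (simp add: axis_halfspace_def axis_point_carrier)
qed

lemma inj_axis_point:
  assumes "d \<ge> 1"
  shows "inj (axis_point d)"
proof (rule injI)
  fix k l
  assume eq: "axis_point d k = axis_point d l"
  have k: "k mod d < d" and l: "l mod d < d"
    using assms by simp_all
  \<comment> \<open>This coordinate is positive on the left, which forces the right point onto the
    same axis.\<close>
  have "axis_point d k $ (k mod d) = axis_point d l $ (k mod d)"
    using eq by simp
  then have "real (k div d) + 1 = (real (l div d) + 1) * (if k mod d = l mod d then 1 else 0)"
    using k l by (simp add: axis_point_def)
  then have "k mod d = l mod d" "k div d = l div d"
    by (auto split: if_splits)
  then show "k = l"
    by (metis div_mult_mod_eq)
qed

section \<open>Labellings of the whole point set as inputs\<close>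

definition labelling :: "real vec set \<Rightarrow> real vec set \<Rightarrow> sample" where
  "labelling U H = (\<lambda>x. (x, if x \<in> H then 1 else -1)) ` U"

lemma labelling_in_learning_inputs:
  "H \<in> halfspaces d \<Longrightarrow> (labelling U H, {}) \<in> learning_inputs d U"
  unfolding learning_inputs_def labelling_def by (auto split: if_splits)

text \<open>Every point of \<open>U\<close> occurs in the sample, so a correct output determines it.
  Hence different labellings share no correct output.\<close>

lemma labelling_eq_graph:
  assumes "f \<in> correct_outputs U (labelling U H) {}"
  shows "labelling U H = (\<lambda>x. (x, f x)) ` U"
  unfolding labelling_def
proof (rule image_cong)
  fix x assume "x \<in> U"
  then show "(x, if x \<in> H then 1 else -1) = (x, f x)"
    using assms unfolding correct_outputs_def labelling_def by fastforce
qed simp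

lemma labelling_eq_imp:
  assumes eq: "labelling U H = labelling U H'" and x: "x \<in> U"
  shows "x \<in> H \<longleftrightarrow> x \<in> H'"
proof -
  have "(x, if x \<in> H then 1 else -1) \<in> labelling U H"
    unfolding labelling_def using x by (rule imageI)
  then show ?thesis
    unfolding eq by (auto simp: labelling_def split: if_splits)
qed

text \<open>With thresholds at most \<open>n div d\<close>, \<open>s i\<close> can be read off as
  the number of the first \<open>n div d\<close> points of axis \<open>i\<close> that lie in the
  halfspace.\<close>

lemma axis_thresholds_unique:
  assumes d: "d \<ge> 1"
    and s: "s \<in> {..<d} \<rightarrow>\<^sub>E {..n div d}" and s': "s' \<in> {..<d} \<rightarrow>\<^sub>E {..n div d}"
    and eq: "\<And>x. x \<in> axis_point d ` {..<n} \<Longrightarrow>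
               x \<in> axis_halfspace d s \<longleftrightarrow> x \<in> axis_halfspace d s'"
  shows "s = s'"
proof (rule PiE_ext[OF s s'])
  fix i assume i: "i \<in> {..<d}"
  have *: "t < s i \<longleftrightarrow> t < s' i" if t: "t < n div d" for t
  proof -
    have "t * d + i < Suc t * d"
      using i by simp
    also have "\<dots> \<le> (n div d) * d"
      using t by (intro mult_right_mono) auto
    also have "\<dots> \<le> n"
      by simp
    finally have "t * d + i < n" .
    then have "axis_point d (t * d + i) \<in> axis_halfspace d s \<longleftrightarrow>
               axis_point d (t * d + i) \<in> axis_halfspace d s'"
      by (intro eq) blast
    then show ?thesis
      using i d by (simp add: axis_point_in_axis_halfspace)
  qed
  \<comment> \<open>If the thresholds differed, the smaller one would be a position below
    \<open>n div d\<close> that only the larger one admits.\<close>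
  have "s i \<le> n div d" "s' i \<le> n div d"
    using s s' i by auto
  then show "s i = s' i"
    using *[of "s i"] *[of "s' i"] by (metis linorder_neqE_nat less_le_trans less_irrefl)
qed

section \<open>The communication bound\<close>

lemma axis_points_bound:
  assumes d: "d \<ge> 1" and U: "U = axis_point d ` {..<n}"
    and learns: "learns_halfspaces d U P"
    and bits: "\<And>p S\<^sub>a S\<^sub>b. p \<in> set_pmf P \<Longrightarrow> (S\<^sub>a, S\<^sub>b) \<in> learning_inputs d U \<Longrightarrow>
                 bits_sent p S\<^sub>a S\<^sub>b \<le> T"
  shows "2 / 3 * real ((n div d + 1) ^ d) \<le> 2 ^ T"
proof -
  define E where "E = {..<d} \<rightarrow>\<^sub>E {..n div d}"
  define inp where "inp s = (labelling U (axis_halfspace d s), {} :: sample)" for s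
  have inp_mem: "inp s \<in> learning_inputs d U" for s
    unfolding inp_def by (intro labelling_in_learning_inputs axis_halfspace_in_halfspaces)
  have inj: "inj_on inp E"
  proof (rule inj_onI)
    fix s s' assume s: "s \<in> E" "s' \<in> E" and "inp s = inp s'"
    then have "labelling U (axis_halfspace d s) = labelling U (axis_halfspace d s')"
      by (simp add: inp_def)
    from labelling_eq_imp[OF this] show "s = s'"
      using s unfolding E_def U by (intro axis_thresholds_unique[OF d])
  qed
  have "2 / 3 * real (card (inp ` E)) \<le> 2 ^ T"
  proof (rule randomized_counting_bound[where C = "\<lambda>(S\<^sub>a, S\<^sub>b). correct_outputs U S\<^sub>a S\<^sub>b"])
    show "finite (inp ` E)"
      unfolding E_def by (intro finite_imageI finite_PiE) auto
    show "bits_sent p x y \<le> T" if "p \<in> set_pmf P" "(x, y) \<in> inp ` E" for p x y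
      using bits inp_mem that by (metis imageE)
    show "disjoint_family_on (\<lambda>(S\<^sub>a, S\<^sub>b). correct_outputs U S\<^sub>a S\<^sub>b) (inp ` E)"
    proof -
      have False if "inp s \<noteq> inp s'"
        "f \<in> correct_outputs U (labelling U (axis_halfspace d s)) {}"
        "f \<in> correct_outputs U (labelling U (axis_halfspace d s')) {}" for s s' f
        using labelling_eq_graph[OF that(2)] labelling_eq_graph[OF that(3)] that(1)
        by (simp add: inp_def)
      then show ?thesis
        by (fastforce simp: disjoint_family_on_def inp_def)
    qed
    show "2 / 3 \<le> measure_pmf.prob P
            {p. run_protocol p x y \<in> (case (x, y) of (S\<^sub>a, S\<^sub>b) \<Rightarrow> correct_outputs U S\<^sub>a S\<^sub>b)}"
      if "(x, y) \<in> inp ` E" for x y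
    proof -
      have "(x, y) \<in> learning_inputs d U"
        using that inp_mem by (metis imageE)
      then show ?thesis
        using learns unfolding learns_halfspaces_def by auto
    qed
  qed
  moreover have "card (inp ` E) = (n div d + 1) ^ d"
    using inj by (simp add: card_image E_def card_PiE)
  ultimately show ?thesis
    by simp
qed

theorem mainTheorem2:
  "\<exists>c::real. c > 0 \<and>
     (\<forall>d n :: nat. d \<ge> 1 \<longrightarrow>
        (\<exists>U. U \<subseteq> carrier_vec d \<and> finite U \<and> card U = n \<and>
           (\<forall>P. learns_halfspaces d U P \<longrightarrow>
              transmits_at_least d U P (c * (real d * log 2 (real n / real d))))))"
\<comment> \<open>The factor \<open>1 / 3\<close> makes the cube of \<open>2 ^ T\<close> at most the
  number of labellings, which exceeds what the loss of \<open>2 / 3\<close> can absorb.\<close>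
proof (intro exI[of _ "1 / 3"] conjI allI impI)
  fix d n :: nat
  assume d: "d \<ge> 1"
  define U where "U = axis_point d ` {..<n}"
  define t where "t = 1 / 3 * (real d * log 2 (real n / real d))"
  have "transmits_at_least d U P t" if learns: "learns_halfspaces d U P" for P
  proof (rule ccontr)
    assume "\<not> transmits_at_least d U P t"
    then have bits: "real (bits_sent p S\<^sub>a S\<^sub>b) < t"
      if "p \<in> set_pmf P" "(S\<^sub>a, S\<^sub>b) \<in> learning_inputs d U" for p S\<^sub>a S\<^sub>b
      using that unfolding transmits_at_least_def by force
    obtain p where p: "p \<in> set_pmf P"
      using set_pmf_not_empty[of P] by blast
    \<comment> \<open>A bit count lies strictly below \<open>t\<close>. This leaves only
      \<open>n > d\<close>: otherwise the claimed bound is not positive, also for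
      \<open>n = 0\<close>, where \<open>log 2 0\<close> is 0.\<close>
    have "0 < t"
      using bits[OF p labelling_in_learning_inputs[OF axis_halfspace_in_halfspaces]]
      by (meson of_nat_0_le_iff order_le_less_trans)
    then have log_pos: "0 < log 2 (real n / real d)"
      using d by (simp add: t_def zero_less_mult_iff)
    have "n > 0"
      using log_pos by (cases n) (auto simp: log_def)
    have "n > d"
      using log_pos d \<open>n > 0\<close> by (simp add: field_simps)
    then have "n div d \<ge> 1"
      using d by (simp add: div_greater_zero_iff Suc_le_eq)
    define T where "T = nat \<lfloor>t\<rfloor>"
    define N where "N = (n div d + 1) ^ d"
    have "bits_sent p S\<^sub>a S\<^sub>b \<le> T"
      if "p \<in> set_pmf P" "(S\<^sub>a, S\<^sub>b) \<in> learning_inputs d U" for p S\<^sub>a S\<^sub>b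
      using bits[OF that] by (simp add: T_def le_nat_floor)
    from axis_points_bound[OF d U_def learns this]
    have upper: "2 / 3 * real N \<le> 2 ^ T"
      by (simp add: N_def)
    have "n div d + 1 \<le> (n div d + 1) ^ d"
      using d by (intro self_le_power) auto
    then have "N \<ge> 2"
      using \<open>n div d \<ge> 1\<close> unfolding N_def by linarith
    \<comment> \<open>The extra threshold per axis makes up for rounding down
      \<open>n / d\<close>.\<close>
    have "n \<le> (n div d + 1) * d"
      using d dividend_less_div_times[of d n] by simp
    then have "real n \<le> real (n div d + 1) * real d"
      unfolding of_nat_mult[symmetric] of_nat_le_iff .
    then have "real n / real d \<le> real (n div d + 1)"
      using d by (simp add: divide_le_eq)
    then have "(real n / real d) ^ d \<le> real N"
      unfolding N_def of_nat_power by (intro power_mono) auto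
    moreover have "real T \<le> t"
      using \<open>0 < t\<close> by (simp add: T_def)
    then have "3 * real T \<le> real d * log 2 (real n / real d)"
      by (simp add: t_def)
    then have "real (T * 3) \<le> log 2 ((real n / real d) ^ d)"
      using \<open>n > 0\<close> d by (simp add: log_nat_power)
    then have "(2 ^ T) ^ 3 \<le> (real n / real d) ^ d"
      using \<open>n > 0\<close> d
      by (subst (asm) le_log_iff) (simp_all add: powr_realpow flip: power_mult of_nat_mult)
    ultimately have lower: "(2 ^ T) ^ 3 \<le> real N"
      by linarith
    show False
    proof (cases T)
      \<comment> \<open>Here \<open>upper\<close> would give \<open>N \<le> 3 / 2\<close>.\<close>
      case 0
      then show ?thesis using upper \<open>N \<ge> 2\<close> by simp
    next
      case (Suc S)
      then have "(2 :: real) \<le> 2 ^ T"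
        by simp
      \<comment> \<open>Now \<open>4 * 2 ^ T \<le> (2 ^ T) ^ 3 \<le> N \<le> 3 / 2 * 2 ^ T\<close>,
        which is absurd.\<close>
      then have "2 * 2 * 2 ^ T \<le> (2 ^ T * 2 ^ T * 2 ^ T :: real)"
        by (intro mult_mono) auto
      then show ?thesis
        using upper lower \<open>2 \<le> 2 ^ T\<close> unfolding power3_eq_cube by linarith
    qed
  qed
  moreover have "card U = n"
    unfolding U_def by (simp add: card_image inj_on_subset[OF inj_axis_point[OF d]])
  ultimately show "\<exists>U. U \<subseteq> carrier_vec d \<and> finite U \<and> card U = n \<and>
           (\<forall>P. learns_halfspaces d U P \<longrightarrow>
              transmits_at_least d U P (1 / 3 * (real d * log 2 (real n / real d))))"
    unfolding t_def by (intro exI[of _ U]) (auto simp: U_def axis_point_carrier)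
qed simp

end
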